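(* For every formula $F$ of the language of $\mathsf{S4V}^-$: if $\mathsf{S4V}^-\vdash F$ then there is a normal realisation $r$ such that $\mathsf{LPV}^-\vdash F^r$.
   Context: $\mathsf{S4V}^-$: classical modal logic with two unary modalities $\Box$ and ${\bf V}$; axioms: all axioms of $\mathsf{S4}$ for $\Box$, ${\bf V}(A\rightarrow B)\rightarrow({\bf V}A\rightarrow{\bf V}B)$, $\Box A\rightarrow{\bf V}A$; rules: Modus Ponens and $\Box$-Necessitation. $\mathsf{LPV}^-$: language of classical propositional logic extended by ${\bf V}A$ and $t{:}A$, with proof terms built from proof variables and proof constants by binary $\cdot$ (application), $+$ (plus) and unary $!$. Axioms: classical propositional tautologies; $t{:}(A\rightarrow B)\rightarrow(s{:}A\rightarrow (t\cdot s){:}B)$; $t{:}A\rightarrow A$; $t{:}A\rightarrow\, !t{:}t{:}A$; $t{:}A\rightarrow (s+t){:}A$, $t{:}A\rightarrow (t+s){:}A$; ${\bf V}(A\rightarrow B)\rightarrow({\bf V}A\rightarrow {\bf V}B)$; $t{:}A\rightarrow {\bf V}A$. Rules: Modus Ponens and Axiom Necessitation (from an axiom $A$ infer $c{:}A$, $c$ a proof constant). A realisation $r$ of an $\mathsf{S4V}^-$ formula $F$ replaces each occurrence of $\Box$ in $F$ by a proof term (so $\Box G$ becomes $t{:}G^r$), yielding an $\mathsf{LPV}^-$ formula $F^r$. Polarity of occurrences of $\Box$: an occurrence in $F$ keeps its polarity in $G\rightarrow F$, $F\land G$, $G\land F$, $F\lor G$, $G\lor F$, $\Box F$, and reverses it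 in $F\rightarrow G$ and $\neg F$; the outermost occurrence in $\Box G$ as a whole formula is positive. A realisation is normal if every negative occurrence of $\Box$ is replaced by a proof variable. *)

theory Defs
  imports Main
begin

text \<open>
  The languages of \<open>S4V\<^sup>-\<close> and \<open>LPV\<^sup>-\<close> differ only in what labels the first kind of modality:
  nothing (a plain box) or a proof term. Hence one datatype with label type \<open>'m\<close>.
\<close>

datatype 'm fm =
    Atom nat
  | Neg "'m fm"  (\<open>\<^bold>\<not> _\<close> [70] 70)
  | And "'m fm" "'m fm"  (infixr \<open>\<^bold>\<and>\<close> 65)
  | Or "'m fm" "'m fm"  (infixr \<open>\<^bold>\<or>\<close> 60)
  | Imp "'m fm" "'m fm"  (infixr \<open>\<^bold>\<rightarrow>\<close> 55)
  | V "'m fm"  (\<open>\<^bold>V _\<close> [70] 70)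
  | Mod 'm "'m fm"  (\<open>_ \<^bold>: _\<close> [71, 70] 70)

datatype tm =
    PVar nat
  | PConst nat
  | App tm tm  (infixl \<open>\<odot>\<close> 80)
  | Plus tm tm  (infixl \<open>\<oplus>\<close> 75)
  | Check tm  (\<open>\<^bold>! _\<close> [90] 90)

type_synonym s4v_fm = "unit fm"
type_synonym lpv_fm = "tm fm"

abbreviation Box :: "s4v_fm \<Rightarrow> s4v_fm"  (\<open>\<^bold>\<box> _\<close> [70] 70)
  where "\<^bold>\<box> A \<equiv> () \<^bold>: A"

text \<open>
  Boolean evaluation treats atoms and all modal formulas as independent propositional atoms, so
  \<open>tautology\<close> holds of all instances of classical tautologies in the extended language.
\<close>

primrec eval :: "('m fm \<Rightarrow> bool) \<Rightarrow> 'm fm \<Rightarrow> bool" where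
  "eval v (Atom n) = v (Atom n)"
| "eval v (\<^bold>\<not> A) = (\<not> eval v A)"
| "eval v (A \<^bold>\<and> B) = (eval v A \<and> eval v B)"
| "eval v (A \<^bold>\<or> B) = (eval v A \<or> eval v B)"
| "eval v (A \<^bold>\<rightarrow> B) = (eval v A \<longrightarrow> eval v B)"
| "eval v (\<^bold>V A) = v (\<^bold>V A)"
| "eval v (m \<^bold>: A) = v (m \<^bold>: A)"

definition tautology :: "'m fm \<Rightarrow> bool" where
  "tautology A \<longleftrightarrow> (\<forall>v. eval v A)"

inductive s4v_axiom :: "s4v_fm \<Rightarrow> bool" where
  "tautology A \<Longrightarrow> s4v_axiom A"
| "s4v_axiom (\<^bold>\<box> (A \<^bold>\<rightarrow> B) \<^bold>\<rightarrow> \<^bold>\<box> A \<^bold>\<rightarrow> \<^bold>\<box> B)"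
| "s4v_axiom (\<^bold>\<box> A \<^bold>\<rightarrow> A)"
| "s4v_axiom (\<^bold>\<box> A \<^bold>\<rightarrow> \<^bold>\<box> \<^bold>\<box> A)"
| "s4v_axiom (\<^bold>V (A \<^bold>\<rightarrow> B) \<^bold>\<rightarrow> \<^bold>V A \<^bold>\<rightarrow> \<^bold>V B)"
| "s4v_axiom (\<^bold>\<box> A \<^bold>\<rightarrow> \<^bold>V A)"

inductive S4V :: "s4v_fm \<Rightarrow> bool"  (\<open>S4V\<^sup>- \<turnstile> _\<close> [50] 50) where
  Ax: "s4v_axiom A \<Longrightarrow> S4V\<^sup>- \<turnstile> A"
| MP: "S4V\<^sup>- \<turnstile> A \<^bold>\<rightarrow> B \<Longrightarrow> S4V\<^sup>- \<turnstile> A \<Longrightarrow> S4V\<^sup>- \<turnstile> B"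
| Nec: "S4V\<^sup>- \<turnstile> A \<Longrightarrow> S4V\<^sup>- \<turnstile> \<^bold>\<box> A"

inductive lpv_axiom :: "lpv_fm \<Rightarrow> bool" where
  "tautology A \<Longrightarrow> lpv_axiom A"
| "lpv_axiom (t \<^bold>: (A \<^bold>\<rightarrow> B) \<^bold>\<rightarrow> s \<^bold>: A \<^bold>\<rightarrow> (t \<odot> s) \<^bold>: B)"
| "lpv_axiom (t \<^bold>: A \<^bold>\<rightarrow> A)"
| "lpv_axiom (t \<^bold>: A \<^bold>\<rightarrow> (\<^bold>! t) \<^bold>: (t \<^bold>: A))"
| "lpv_axiom (t \<^bold>: A \<^bold>\<rightarrow> (s \<oplus> t) \<^bold>: A)"
| "lpv_axiom (t \<^bold>: A \<^bold>\<rightarrow> (t \<oplus> s) \<^bold>: A)"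
| "lpv_axiom (\<^bold>V (A \<^bold>\<rightarrow> B) \<^bold>\<rightarrow> \<^bold>V A \<^bold>\<rightarrow> \<^bold>V B)"
| "lpv_axiom (t \<^bold>: A \<^bold>\<rightarrow> \<^bold>V A)"

inductive LPV :: "lpv_fm \<Rightarrow> bool"  (\<open>LPV\<^sup>- \<turnstile> _\<close> [50] 50) where
  Ax: "lpv_axiom A \<Longrightarrow> LPV\<^sup>- \<turnstile> A"
| MP: "LPV\<^sup>- \<turnstile> A \<^bold>\<rightarrow> B \<Longrightarrow> LPV\<^sup>- \<turnstile> A \<Longrightarrow> LPV\<^sup>- \<turnstile> B"
| AxNec: "lpv_axiom A \<Longrightarrow> LPV\<^sup>- \<turnstile> PConst c \<^bold>: A"

text \<open>
  An occurrence of a subformula is addressed by the path leading to it from the root: \<open>0\<close> goes to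
  the only or left immediate subformula, \<open>1\<close> to the right one. A realisation assigns a proof term
  to every path; only its values at box occurrences matter.
\<close>

type_synonym path = "nat list"

primrec realise :: "(path \<Rightarrow> tm) \<Rightarrow> s4v_fm \<Rightarrow> lpv_fm" where
  "realise r (Atom n) = Atom n"
| "realise r (\<^bold>\<not> A) = \<^bold>\<not> realise (\<lambda>p. r (0 # p)) A"
| "realise r (A \<^bold>\<and> B) = realise (\<lambda>p. r (0 # p)) A \<^bold>\<and> realise (\<lambda>p. r (1 # p)) B"
| "realise r (A \<^bold>\<or> B) = realise (\<lambda>p. r (0 # p)) A \<^bold>\<or> realise (\<lambda>p. r (1 # p)) B"
| "realise r (A \<^bold>\<rightarrow> B) = realise (\<lambda>p. r (0 # p)) A \<^bold>\<rightarrow> realise (\<lambda>p. r (1 # p)) B"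
| "realise r (\<^bold>V A) = \<^bold>V realise (\<lambda>p. r (0 # p)) A"
| "realise r (_ \<^bold>: A) = r [] \<^bold>: realise (\<lambda>p. r (0 # p)) A"

text \<open>
  \<open>boxes True F\<close> and \<open>boxes False F\<close> are the positive and the negative occurrences of the box
  in \<open>F\<close>. Like the box, \<open>V\<close> preserves polarity.
\<close>

primrec boxes :: "bool \<Rightarrow> s4v_fm \<Rightarrow> path set" where
  "boxes s (Atom n) = {}"
| "boxes s (\<^bold>\<not> A) = (#) 0 ` boxes (\<not> s) A"
| "boxes s (A \<^bold>\<and> B) = (#) 0 ` boxes s A \<union> (#) 1 ` boxes s B"
| "boxes s (A \<^bold>\<or> B) = (#) 0 ` boxes s A \<union> (#) 1 ` boxes s B"
| "boxes s (A \<^bold>\<rightarrow> B) = (#) 0 ` boxes (\<not> s) A \<union> (#) 1 ` boxes s B"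
| "boxes s (\<^bold>V A) = (#) 0 ` boxes s A"
| "boxes s (_ \<^bold>: A) = (if s then {[]} else {}) \<union> (#) 0 ` boxes s A"

definition normal_realisation :: "s4v_fm \<Rightarrow> (path \<Rightarrow> tm) \<Rightarrow> bool" where
  "normal_realisation F r \<longleftrightarrow> (\<forall>p \<in> boxes False F. \<exists>x. r p = PVar x)"

end

theory Submission
  imports Defs
begin

text \<open>
  Extend \<open>LPV\<^sup>-\<close> by a universal term \<open>u\<close> that absorbs every term \<open>t\<close> not containing \<open>u\<close>, i.e.
  \<open>t \<^bold>: A \<^bold>\<rightarrow> u \<^bold>: A\<close>, and by a term \<open>d\<close> naming all these absorption principles. Realise negative
  boxes by one variable \<open>x\<close> and positive ones by \<open>u\<close>. If the result were unprovable in the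
  extension, then the canonical model, whose accessibility relation for the box only looks at
  terms without \<open>u\<close>, would be an \<open>S4V\<^sup>-\<close> model refuting the formula: where \<open>u \<^bold>: A\<close> fails, all
  \<open>t \<^bold>: A\<close> with \<open>t\<close> free of \<open>u\<close> fail, and internalisation never introduces \<open>u\<close>. A derivation in
  the extension absorbs only finitely many terms, so substituting their sum for \<open>u\<close> (and a suitable
  closed term for \<open>d\<close>) turns it into a derivation in \<open>LPV\<^sup>-\<close>.
\<close>

section \<open>The logic with a universal term\<close>

text \<open>The terms \<open>u\<close> and \<open>d\<close> of the extension are ordinary proof
  variables, so the term language stays the same and eliminating them is a substitution.\<close>

abbreviation neg_var :: tm where "neg_var \<equiv> PVar 0"
abbreviation univ_var :: tm where "univ_var \<equiv> PVar 1"
abbreviation absorb_var :: tm where "absorb_var \<equiv> PVar 2"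

primrec univ_free :: "tm \<Rightarrow> bool" where
  "univ_free (PVar n) = (n \<noteq> 1)"
| "univ_free (PConst c) = True"
| "univ_free (t \<odot> s) = (univ_free t \<and> univ_free s)"
| "univ_free (t \<oplus> s) = (univ_free t \<and> univ_free s)"
| "univ_free (\<^bold>! t) = univ_free t"

text \<open>Absorption enters already labelled by \<open>absorb_var\<close>: the bare implication
  follows by reflection, and \<open>!\<close> internalises the rule.\<close>

inductive LPVU :: "lpv_fm \<Rightarrow> bool" where
  Ax: "lpv_axiom A \<Longrightarrow> LPVU A"
| MP: "LPVU (A \<^bold>\<rightarrow> B) \<Longrightarrow> LPVU A \<Longrightarrow> LPVU B"
| AxNec: "lpv_axiom A \<Longrightarrow> LPVU (PConst c \<^bold>: A)"
| Absorb: "univ_free t \<Longrightarrow> LPVU (absorb_var \<^bold>: (t \<^bold>: A \<^bold>\<rightarrow> univ_var \<^bold>: A))"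

lemma LPVU_taut: "tautology A \<Longrightarrow> LPVU A"
  by (intro LPVU.Ax lpv_axiom.intros)

lemma LPVU_absorb: "univ_free t \<Longrightarrow> LPVU (t \<^bold>: A \<^bold>\<rightarrow> univ_var \<^bold>: A)"
  using LPVU.MP LPVU.Ax lpv_axiom.intros(3) LPVU.Absorb by blast

lemma LPVU_app: "LPVU (t \<^bold>: (A \<^bold>\<rightarrow> B)) \<Longrightarrow> LPVU (s \<^bold>: A) \<Longrightarrow> LPVU ((t \<odot> s) \<^bold>: B)"
  using LPVU.MP LPVU.Ax lpv_axiom.intros(2) by blast

lemma LPVU_check: "LPVU (t \<^bold>: A) \<Longrightarrow> LPVU ((\<^bold>! t) \<^bold>: t \<^bold>: A)"
  using LPVU.MP LPVU.Ax lpv_axiom.intros(4) by blast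

text \<open>Axioms receive a constant, modus ponens becomes application, and labelled conclusions
  are internalised by \<open>!\<close>; none of these introduces \<open>univ_var\<close>.\<close>

lemma LPVU_internalise: "LPVU A \<Longrightarrow> \<exists>t. univ_free t \<and> LPVU (t \<^bold>: A)"
proof (induction rule: LPVU.induct)
  case (Ax A)
  then show ?case
    using LPVU.AxNec[of A 0] univ_free.simps(2) by blast
next
  case (MP A B)
  then show ?case
    using LPVU_app univ_free.simps(3) by blast
next
  case (AxNec A c)
  then show ?case
    using LPVU_check LPVU.AxNec univ_free.simps(2,5) by blast
next
  case (Absorb t A)
  have "univ_free (\<^bold>! absorb_var)" by simp
  with Absorb show ?case
    using LPVU_check LPVU.Absorb by blast
qed

lemma LPVU_V: "LPVU A \<Longrightarrow> LPVU (\<^bold>V A)"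
  using LPVU_internalise LPVU.MP LPVU.Ax lpv_axiom.intros(8) by blast

section \<open>Elimination of the universal term\<close>

primrec subst :: "(nat \<Rightarrow> tm) \<Rightarrow> tm \<Rightarrow> tm" where
  "subst \<sigma> (PVar n) = \<sigma> n"
| "subst \<sigma> (PConst c) = PConst c"
| "subst \<sigma> (t \<odot> s) = subst \<sigma> t \<odot> subst \<sigma> s"
| "subst \<sigma> (t \<oplus> s) = subst \<sigma> t \<oplus> subst \<sigma> s"
| "subst \<sigma> (\<^bold>! t) = \<^bold>! subst \<sigma> t"

lemma subst_univ_free: "univ_free t \<Longrightarrow> subst (\<sigma>(1 := s)) t = subst \<sigma> t"
  by (induction t) auto

text \<open>Relabelling may identify modal formulas. This is harmless: valuations pull back along
  it, so tautologies are preserved.\<close>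

lemma eval_map_fm: "eval v (map_fm f A) = eval (v \<circ> map_fm f) A"
  by (induction A) auto

lemma tautology_map_fm: "tautology A \<Longrightarrow> tautology (map_fm f A)"
  by (simp add: tautology_def eval_map_fm)

lemma lpv_axiom_subst: "lpv_axiom A \<Longrightarrow> lpv_axiom (map_fm (subst \<sigma>) A)"
  by (induction rule: lpv_axiom.induct) (auto intro: lpv_axiom.intros tautology_map_fm)

text \<open>The instances of \<open>Absorb\<close> for \<open>t\<close> after substitution. All
  \<open>B\<close> are covered at once, so only terms need to be collected from a
  derivation.\<close>

definition absorbed :: "(nat \<Rightarrow> tm) \<Rightarrow> tm \<Rightarrow> bool" where
  "absorbed \<sigma> t \<longleftrightarrow> (\<forall>B. LPV\<^sup>- \<turnstile> \<sigma> 2 \<^bold>: (subst \<sigma> t \<^bold>: B \<^bold>\<rightarrow> \<sigma> 1 \<^bold>: B))"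

text \<open>A derivation applies \<open>Absorb\<close> to finitely many terms; \<open>T\<close> is
  fixed before \<sigma> is chosen.\<close>

lemma LPVU_finite_absorption:
  "LPVU A \<Longrightarrow> \<exists>T. finite T \<and> (\<forall>t\<in>T. univ_free t) \<and>
     (\<forall>\<sigma>. (\<forall>t\<in>T. absorbed \<sigma> t) \<longrightarrow> LPV\<^sup>- \<turnstile> map_fm (subst \<sigma>) A)"
proof (induction rule: LPVU.induct)
  case (Ax A)
  then show ?case
    by (intro exI[of _ "{}"]) (simp add: LPV.Ax lpv_axiom_subst)
next
  case (MP A B)
  then obtain T T' where "finite T" "\<forall>t\<in>T. univ_free t" "finite T'" "\<forall>t\<in>T'. univ_free t"
    and "\<And>\<sigma>. \<forall>t\<in>T. absorbed \<sigma> t \<Longrightarrow> LPV\<^sup>- \<turnstile> map_fm (subst \<sigma>) A \<^bold>\<rightarrow> map_fm (subst \<sigma>) B"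
    and "\<And>\<sigma>. \<forall>t\<in>T'. absorbed \<sigma> t \<Longrightarrow> LPV\<^sup>- \<turnstile> map_fm (subst \<sigma>) A"
    by auto
  then have "LPV\<^sup>- \<turnstile> map_fm (subst \<sigma>) B" if "\<forall>t\<in>T \<union> T'. absorbed \<sigma> t" for \<sigma>
    using that LPV.MP by (meson UnCI)
  with \<open>finite T\<close> \<open>finite T'\<close> \<open>\<forall>t\<in>T. univ_free t\<close> \<open>\<forall>t\<in>T'. univ_free t\<close> show ?case
    by (intro exI[of _ "T \<union> T'"]) auto
next
  case (AxNec A c)
  then show ?case
    by (intro exI[of _ "{}"]) (simp add: LPV.AxNec lpv_axiom_subst)
next
  case (Absorb t A)
  then show ?case
    by (intro exI[of _ "{t}"]) (simp add: absorbed_def)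
qed

primrec sum_tm :: "tm list \<Rightarrow> tm" where
  "sum_tm [] = PConst 0"
| "sum_tm (t # ts) = t \<oplus> sum_tm ts"

lemma LPV_app: "LPV\<^sup>- \<turnstile> t \<^bold>: (A \<^bold>\<rightarrow> B) \<Longrightarrow> LPV\<^sup>- \<turnstile> s \<^bold>: A \<Longrightarrow> LPV\<^sup>- \<turnstile> (t \<odot> s) \<^bold>: B"
  using LPV.MP LPV.Ax lpv_axiom.intros(2) by blast

lemma LPV_plus_left: "LPV\<^sup>- \<turnstile> t \<^bold>: A \<Longrightarrow> LPV\<^sup>- \<turnstile> (t \<oplus> s) \<^bold>: A"
  using LPV.MP LPV.Ax lpv_axiom.intros(6) by blast

lemma LPV_plus_right: "LPV\<^sup>- \<turnstile> t \<^bold>: A \<Longrightarrow> LPV\<^sup>- \<turnstile> (s \<oplus> t) \<^bold>: A"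
  using LPV.MP LPV.Ax lpv_axiom.intros(5) by blast

text \<open>
  The term \<open>d\<close> must not depend on the summands, because these may themselves contain \<open>d\<close> after the
  substitution.
\<close>

lemma sum_tm_absorbs:
  "\<exists>d. \<forall>ts. length ts = n \<longrightarrow> (\<forall>t\<in>set ts. \<forall>A. LPV\<^sup>- \<turnstile> d \<^bold>: (t \<^bold>: A \<^bold>\<rightarrow> sum_tm ts \<^bold>: A))"
proof (induction n)
  case 0
  then show ?case by simp
next
  case (Suc n)
  then obtain d where d: "LPV\<^sup>- \<turnstile> d \<^bold>: (t \<^bold>: A \<^bold>\<rightarrow> sum_tm ts \<^bold>: A)"
    if "length ts = n" "t \<in> set ts" for ts t A
    by blast
  \<comment> \<open>In the new term, the left summand labels the plus axiom for the head of the
    list. The right one labels the composition of the inductive implication with a further plus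
    axiom. One constant may label all axioms.\<close>
  let ?c = "PConst 0"
  have "LPV\<^sup>- \<turnstile> (?c \<oplus> (?c \<odot> d \<odot> ?c)) \<^bold>: (t \<^bold>: A \<^bold>\<rightarrow> sum_tm ts \<^bold>: A)"
    if ts: "length ts = Suc n" "t \<in> set ts" for ts t A
  proof -
    obtain s ts' where [simp]: "ts = s # ts'" and "length ts' = n"
      using ts(1) by (cases ts) auto
    consider "t = s" | "t \<in> set ts'"
      using ts(2) by auto
    then show ?thesis
    proof cases
      case 1
      then show ?thesis
        by (simp add: LPV_plus_left LPV.AxNec lpv_axiom.intros(6))
    next
      case 2
      let ?P = "t \<^bold>: A" and ?Q = "sum_tm ts' \<^bold>: A" and ?R = "sum_tm ts \<^bold>: A"
      have "LPV\<^sup>- \<turnstile> ?c \<^bold>: ((?P \<^bold>\<rightarrow> ?Q) \<^bold>\<rightarrow> (?Q \<^bold>\<rightarrow> ?R) \<^bold>\<rightarrow> ?P \<^bold>\<rightarrow> ?R)"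
        by (intro LPV.AxNec lpv_axiom.intros(1)) (simp add: tautology_def)
      moreover have "LPV\<^sup>- \<turnstile> d \<^bold>: (?P \<^bold>\<rightarrow> ?Q)"
        using d \<open>length ts' = n\<close> 2 .
      moreover have "LPV\<^sup>- \<turnstile> ?c \<^bold>: (?Q \<^bold>\<rightarrow> ?R)"
        by (simp add: LPV.AxNec lpv_axiom.intros(5))
      ultimately show ?thesis
        by (intro LPV_plus_right) (rule LPV_app[OF LPV_app])
    qed
  qed
  then show ?case by blast
qed

lemma LPVU_eliminate:
  assumes "LPVU A"
  shows "\<exists>\<sigma>. \<sigma> 0 = neg_var \<and> LPV\<^sup>- \<turnstile> map_fm (subst \<sigma>) A"
proof -
  obtain T where "finite T" and free: "\<forall>t\<in>T. univ_free t"
    and T: "\<And>\<sigma>. \<forall>t\<in>T. absorbed \<sigma> t \<Longrightarrow> LPV\<^sup>- \<turnstile> map_fm (subst \<sigma>) A"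
    using LPVU_finite_absorption[OF assms] by auto
  obtain ts where [simp]: "T = set ts"
    using \<open>finite T\<close> finite_list by blast
  obtain d where d: "LPV\<^sup>- \<turnstile> d \<^bold>: (t \<^bold>: B \<^bold>\<rightarrow> sum_tm ss \<^bold>: B)"
    if "length ss = length ts" "t \<in> set ss" for ss t B
    using sum_tm_absorbs[of "length ts"] by metis
  \<comment> \<open>First \<open>d\<close>, which depends only on the length of \<open>ts\<close>,
    then the sum for \<open>univ_var\<close>. Since the terms in \<open>ts\<close> are free of
    \<open>univ_var\<close>, the second update does not alter their substitution instances.\<close>
  define \<sigma> where "\<sigma> = PVar(2 := d)"
  define \<tau> where "\<tau> = \<sigma>(1 := sum_tm (map (subst \<sigma>) ts))"
  have "LPV\<^sup>- \<turnstile> \<tau> 2 \<^bold>: (subst \<tau> t \<^bold>: B \<^bold>\<rightarrow> \<tau> 1 \<^bold>: B)" if "t \<in> T" for t B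
  proof -
    have "subst \<tau> t = subst \<sigma> t"
      unfolding \<tau>_def using free that by (intro subst_univ_free) blast
    moreover have "LPV\<^sup>- \<turnstile> d \<^bold>: (subst \<sigma> t \<^bold>: B \<^bold>\<rightarrow> sum_tm (map (subst \<sigma>) ts) \<^bold>: B)"
      using that by (intro d) auto
    ultimately show ?thesis
      by (simp add: \<tau>_def \<sigma>_def)
  qed
  then have "LPV\<^sup>- \<turnstile> map_fm (subst \<tau>) A"
    using T by (auto simp: absorbed_def)
  then show ?thesis
    by (intro exI[of _ \<tau>]) (simp add: \<tau>_def \<sigma>_def)
qed

section \<open>Derivability from assumptions and maximal consistent sets\<close>

text \<open>Modus ponens is the only rule applied to hypotheses; constants label axioms only inside
  \<open>LPVU\<close>. This gives the deduction theorem.\<close>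

inductive entails :: "lpv_fm set \<Rightarrow> lpv_fm \<Rightarrow> bool"  (infix \<open>\<tturnstile>\<close> 50) for S where
  Hyp: "A \<in> S \<Longrightarrow> S \<tturnstile> A"
| Thm: "LPVU A \<Longrightarrow> S \<tturnstile> A"
| MP: "S \<tturnstile> A \<^bold>\<rightarrow> B \<Longrightarrow> S \<tturnstile> A \<Longrightarrow> S \<tturnstile> B"

lemma entails_axiom: "lpv_axiom A \<Longrightarrow> S \<tturnstile> A"
  by (intro entails.Thm LPVU.Ax)

lemma entails_taut: "tautology A \<Longrightarrow> S \<tturnstile> A"
  by (intro entails.Thm LPVU_taut)

lemma entails_mono: "S \<tturnstile> A \<Longrightarrow> S \<subseteq> S' \<Longrightarrow> S' \<tturnstile> A"
  by (induction rule: entails.induct) (auto intro: entails.intros)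

lemma entails_empty: "{} \<tturnstile> A \<Longrightarrow> LPVU A"
  by (induction rule: entails.induct) (auto intro: LPVU.MP)

lemma entails_compact: "S \<tturnstile> A \<Longrightarrow> \<exists>S0. finite S0 \<and> S0 \<subseteq> S \<and> S0 \<tturnstile> A"
proof (induction rule: entails.induct)
  case (Hyp A)
  then show ?case
    by (intro exI[of _ "{A}"]) (auto intro: entails.Hyp)
next
  case (Thm A)
  then show ?case
    by (intro exI[of _ "{}"]) (auto intro: entails.Thm)
next
  case (MP A B)
  then obtain S1 S2 where "finite S1" "S1 \<subseteq> S" "S1 \<tturnstile> A \<^bold>\<rightarrow> B" "finite S2" "S2 \<subseteq> S" "S2 \<tturnstile> A"
    by blast
  then have "S1 \<union> S2 \<tturnstile> B"
    by (meson entails.MP entails_mono Un_upper1 Un_upper2)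
  with \<open>finite S1\<close> \<open>S1 \<subseteq> S\<close> \<open>finite S2\<close> \<open>S2 \<subseteq> S\<close> show ?case
    by (intro exI[of _ "S1 \<union> S2"]) auto
qed

lemma entails_deduction: "insert B S \<tturnstile> A \<Longrightarrow> S \<tturnstile> B \<^bold>\<rightarrow> A"
proof (induction rule: entails.induct)
  case (Hyp A)
  show ?case
  proof (cases "A = B")
    case True
    then show ?thesis
      by (intro entails_taut) (simp add: tautology_def)
  next
    case False
    have "S \<tturnstile> A \<^bold>\<rightarrow> B \<^bold>\<rightarrow> A"
      by (intro entails_taut) (simp add: tautology_def)
    with False Hyp show ?thesis
      by (auto intro: entails.intros)
  qed
next
  case (Thm A)
  have "S \<tturnstile> A \<^bold>\<rightarrow> B \<^bold>\<rightarrow> A"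
    by (intro entails_taut) (simp add: tautology_def)
  with Thm show ?case
    by (auto intro: entails.intros)
next
  case (MP A C)
  have "S \<tturnstile> (B \<^bold>\<rightarrow> A \<^bold>\<rightarrow> C) \<^bold>\<rightarrow> (B \<^bold>\<rightarrow> A) \<^bold>\<rightarrow> B \<^bold>\<rightarrow> C"
    by (intro entails_taut) (simp add: tautology_def)
  with MP show ?case
    by (meson entails.MP)
qed

text \<open>Canonical accessibility: \<open>M\<close> is seen from \<open>S\<close> via the box when
  \<open>proven S \<subseteq> M\<close>, and via \<open>V\<close> when
  \<open>valid S \<subseteq> M\<close>.\<close>

definition proven :: "lpv_fm set \<Rightarrow> lpv_fm set" where
  "proven S = {A. \<exists>t. univ_free t \<and> t \<^bold>: A \<in> S}"

definition valid :: "lpv_fm set \<Rightarrow> lpv_fm set" where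
  "valid S = {A. \<^bold>V A \<in> S}"

text \<open>Hypotheses bring their own terms, theorems are internalised, and modus ponens becomes
  application. The contrapositive yields box successors that omit \<open>A\<close>.\<close>

lemma entails_internalise: "proven S \<tturnstile> A \<Longrightarrow> \<exists>t. univ_free t \<and> S \<tturnstile> t \<^bold>: A"
proof (induction rule: entails.induct)
  case (Hyp A)
  then show ?case
    by (auto simp: proven_def intro: entails.Hyp)
next
  case (Thm A)
  then show ?case
    using LPVU_internalise entails.Thm by blast
next
  case (MP A B)
  then obtain t s where "univ_free (t \<odot> s)" "S \<tturnstile> t \<^bold>: (A \<^bold>\<rightarrow> B)" "S \<tturnstile> s \<^bold>: A"
    by auto
  then show ?case
    using entails.MP entails_axiom lpv_axiom.intros(2) by blast
qed

lemma entails_V: "valid S \<tturnstile> A \<Longrightarrow> S \<tturnstile> \<^bold>V A"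
proof (induction rule: entails.induct)
  case (Hyp A)
  then show ?case
    by (auto simp: valid_def intro: entails.Hyp)
next
  case (Thm A)
  then show ?case
    using LPVU_V entails.Thm by blast
next
  case (MP A B)
  then show ?case
    using entails.MP entails_axiom lpv_axiom.intros(7) by blast
qed

text \<open>Consistency is implied: an inconsistent closed set would contain both a formula and its
  negation.\<close>

definition mcs :: "lpv_fm set \<Rightarrow> bool" where
  "mcs S \<longleftrightarrow> (\<forall>A. S \<tturnstile> A \<longrightarrow> A \<in> S) \<and> (\<forall>A. \<^bold>\<not> A \<in> S \<longleftrightarrow> A \<notin> S)"

lemma mcs_closed: "mcs S \<Longrightarrow> S \<tturnstile> A \<Longrightarrow> A \<in> S"
  by (simp add: mcs_def)

lemma mcs_Neg: "mcs S \<Longrightarrow> \<^bold>\<not> A \<in> S \<longleftrightarrow> A \<notin> S"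
  by (simp add: mcs_def)

lemma mcs_MP: "mcs S \<Longrightarrow> LPVU (A \<^bold>\<rightarrow> B) \<Longrightarrow> A \<in> S \<Longrightarrow> B \<in> S"
  by (rule mcs_closed) (auto intro: entails.Thm entails.Hyp entails.MP[of S A B])

lemma mcs_axiom_MP: "mcs S \<Longrightarrow> lpv_axiom (A \<^bold>\<rightarrow> B) \<Longrightarrow> A \<in> S \<Longrightarrow> B \<in> S"
  by (rule mcs_MP[OF _ LPVU.Ax])

lemma mcs_taut_MP: "mcs S \<Longrightarrow> tautology (A \<^bold>\<rightarrow> B) \<Longrightarrow> A \<in> S \<Longrightarrow> B \<in> S"
  by (rule mcs_MP[OF _ LPVU_taut])

lemma mcs_Imp:
  assumes "mcs S"
  shows "A \<^bold>\<rightarrow> B \<in> S \<longleftrightarrow> (A \<in> S \<longrightarrow> B \<in> S)"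
proof
  show "A \<^bold>\<rightarrow> B \<in> S \<Longrightarrow> A \<in> S \<longrightarrow> B \<in> S"
    by (intro impI mcs_closed[OF assms]) (rule entails.MP[OF entails.Hyp entails.Hyp])
  have "\<^bold>\<not> A \<in> S \<Longrightarrow> A \<^bold>\<rightarrow> B \<in> S" "B \<in> S \<Longrightarrow> A \<^bold>\<rightarrow> B \<in> S"
    by (rule mcs_taut_MP[OF assms]; simp add: tautology_def)+
  then show "A \<in> S \<longrightarrow> B \<in> S \<Longrightarrow> A \<^bold>\<rightarrow> B \<in> S"
    using mcs_Neg[OF assms] by blast
qed

lemma mcs_equiv:
  assumes "mcs S" "tautology (A \<^bold>\<rightarrow> B)" "tautology (B \<^bold>\<rightarrow> A)"
  shows "A \<in> S \<longleftrightarrow> B \<in> S"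
  by (rule iffI) (fact mcs_taut_MP[OF assms(1,2)] mcs_taut_MP[OF assms(1,3)])+

lemma mcs_Or: "mcs S \<Longrightarrow> A \<^bold>\<or> B \<in> S \<longleftrightarrow> A \<in> S \<or> B \<in> S"
  by (subst mcs_equiv[of S _ "\<^bold>\<not> A \<^bold>\<rightarrow> B"]) (auto simp: tautology_def mcs_Imp mcs_Neg)

lemma mcs_And: "mcs S \<Longrightarrow> A \<^bold>\<and> B \<in> S \<longleftrightarrow> A \<in> S \<and> B \<in> S"
  by (subst mcs_equiv[of S _ "\<^bold>\<not> (A \<^bold>\<rightarrow> \<^bold>\<not> B)"]) (auto simp: tautology_def mcs_Imp mcs_Neg)

text \<open>Zorn's lemma on the supersets of \<open>S\<close> that do not derive \<open>A\<close>;
  compactness handles unions of chains.\<close>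

lemma lindenbaum:
  assumes "\<not> S \<tturnstile> A"
  shows "\<exists>M. mcs M \<and> S \<subseteq> M \<and> A \<notin> M"
proof -
  define \<A> where "\<A> = {M. S \<subseteq> M \<and> \<not> M \<tturnstile> A}"
  have "S \<in> \<A>"
    using assms by (simp add: \<A>_def)
  moreover have "\<Union>\<C> \<in> \<A>" if chain: "\<C> \<noteq> {}" "subset.chain \<A> \<C>" for \<C>
  proof -
    have "\<C> \<subseteq> \<A>"
      using chain(2) by (simp add: subset_chain_def)
    have "\<not> \<Union>\<C> \<tturnstile> A"
    proof
      assume "\<Union>\<C> \<tturnstile> A"
      then obtain S0 where "finite S0" "S0 \<subseteq> \<Union>\<C>" "S0 \<tturnstile> A"
        using entails_compact by blast
      then obtain M where "M \<in> \<C>" "S0 \<subseteq> M"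
        using finite_subset_Union_chain[OF _ _ chain] by metis
      then show False
        using \<open>S0 \<tturnstile> A\<close> \<open>\<C> \<subseteq> \<A>\<close> entails_mono unfolding \<A>_def by blast
    qed
    then show ?thesis
      using \<open>\<C> \<subseteq> \<A>\<close> \<open>\<C> \<noteq> {}\<close> by (auto simp: \<A>_def)
  qed
  ultimately obtain M where "M \<in> \<A>" and max: "\<forall>N\<in>\<A>. M \<subseteq> N \<longrightarrow> N = M"
    using subset_Zorn_nonempty[of \<A>] by blast
  then have M: "S \<subseteq> M" "\<not> M \<tturnstile> A"
    by (auto simp: \<A>_def)
  \<comment> \<open>By maximality, adding any \<open>B\<close> outside \<open>M\<close> makes
    \<open>A\<close> derivable.\<close>
  have out: "M \<tturnstile> B \<^bold>\<rightarrow> A" if "B \<notin> M" for B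
    using that M(1) max[rule_format, of "insert B M"]
    by (intro entails_deduction) (auto simp: \<A>_def)
  have "B \<in> M" if "M \<tturnstile> B" for B
    using that out M entails.MP by blast
  moreover have "\<^bold>\<not> B \<in> M \<longleftrightarrow> B \<notin> M" for B
  proof -
    \<comment> \<open>If both \<open>B\<close> and its negation are in \<open>M\<close>, then
      \<open>A\<close> follows by ex falso; if neither is, both imply \<open>A\<close> by
      \<open>out\<close>.\<close>
    have "M \<tturnstile> B \<^bold>\<rightarrow> \<^bold>\<not> B \<^bold>\<rightarrow> A" "M \<tturnstile> (B \<^bold>\<rightarrow> A) \<^bold>\<rightarrow> (\<^bold>\<not> B \<^bold>\<rightarrow> A) \<^bold>\<rightarrow> A"
      by (intro entails_taut; auto simp: tautology_def)+
    then show ?thesis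
      using out[of B] out[of "\<^bold>\<not> B"] M entails.MP entails.Hyp by blast
  qed
  ultimately have "mcs M"
    by (simp add: mcs_def)
  with M show ?thesis
    using entails.Hyp by blast
qed

section \<open>The canonical model\<close>

text \<open>Kripke truth of modal formulas at worlds that are themselves sets of formulas with
  terms.\<close>

primrec holds :: "s4v_fm \<Rightarrow> lpv_fm set \<Rightarrow> bool" where
  "holds (Atom n) S = (Atom n \<in> S)"
| "holds (\<^bold>\<not> A) S = (\<not> holds A S)"
| "holds (A \<^bold>\<and> B) S = (holds A S \<and> holds B S)"
| "holds (A \<^bold>\<or> B) S = (holds A S \<or> holds B S)"
| "holds (A \<^bold>\<rightarrow> B) S = (holds A S \<longrightarrow> holds B S)"
| "holds (\<^bold>V A) S = (\<forall>M. mcs M \<longrightarrow> valid S \<subseteq> M \<longrightarrow> holds A M)"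
| "holds (_ \<^bold>: A) S = (\<forall>M. mcs M \<longrightarrow> proven S \<subseteq> M \<longrightarrow> holds A M)"

lemma holds_eval: "eval (\<lambda>B. holds B S) A = holds A S"
  by (induction A) auto

lemma proven_refl: "mcs S \<Longrightarrow> proven S \<subseteq> S"
  using mcs_axiom_MP lpv_axiom.intros(3) unfolding proven_def by blast

text \<open>Transitivity of box accessibility, from the axiom for \<open>!\<close>, which keeps
  terms \<open>univ_free\<close>.\<close>

lemma proven_trans:
  assumes "mcs S" "proven S \<subseteq> M"
  shows "proven S \<subseteq> proven M"
proof
  fix A
  assume "A \<in> proven S"
  then obtain t where t: "univ_free t" "t \<^bold>: A \<in> S"
    by (auto simp: proven_def)
  then have "(\<^bold>! t) \<^bold>: t \<^bold>: A \<in> S"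
    using assms(1) mcs_axiom_MP lpv_axiom.intros(4) by blast
  moreover have "univ_free (\<^bold>! t)"
    using t by simp
  ultimately have "t \<^bold>: A \<in> M"
    using assms(2) unfolding proven_def by blast
  with t show "A \<in> proven M"
    by (auto simp: proven_def)
qed

text \<open>Hence every \<open>V\<close>-successor is a box successor, the frame condition linking
  the two modalities.\<close>

lemma proven_subset_valid: "mcs S \<Longrightarrow> proven S \<subseteq> valid S"
  using mcs_axiom_MP lpv_axiom.intros(8) unfolding proven_def valid_def by blast

lemma canonical_axiom:
  assumes "s4v_axiom A" "mcs S"
  shows "holds A S"
  using assms
proof (induction rule: s4v_axiom.induct)
  case (1 A)
  then show ?case
    using holds_eval[of S A] by (simp add: tautology_def)
next
  case (3 A)
  then show ?case
    using proven_refl[OF \<open>mcs S\<close>] by simp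
next
  case (4 A)
  then show ?case
    using subset_trans[OF proven_trans[OF \<open>mcs S\<close>]] by simp
next
  case (6 A)
  then show ?case
    using subset_trans[OF proven_subset_valid[OF \<open>mcs S\<close>]] by simp
\<comment> \<open>The two distribution axioms hold for any accessibility relation.\<close>
qed auto

lemma canonical_sound: "S4V\<^sup>- \<turnstile> A \<Longrightarrow> mcs S \<Longrightarrow> holds A S"
  by (induction arbitrary: S rule: S4V.induct) (auto simp: canonical_axiom)

text \<open>The flag \<open>s\<close> carries the polarity. The parameter \<open>u\<close> lets the
  same function describe the formula before and after \<open>univ_var\<close> is eliminated.\<close>

primrec polar_realise :: "tm \<Rightarrow> bool \<Rightarrow> s4v_fm \<Rightarrow> lpv_fm" where
  "polar_realise u s (Atom n) = Atom n"
| "polar_realise u s (\<^bold>\<not> A) = \<^bold>\<not> polar_realise u (\<not> s) A"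
| "polar_realise u s (A \<^bold>\<and> B) = polar_realise u s A \<^bold>\<and> polar_realise u s B"
| "polar_realise u s (A \<^bold>\<or> B) = polar_realise u s A \<^bold>\<or> polar_realise u s B"
| "polar_realise u s (A \<^bold>\<rightarrow> B) = polar_realise u (\<not> s) A \<^bold>\<rightarrow> polar_realise u s B"
| "polar_realise u s (\<^bold>V A) = \<^bold>V polar_realise u s A"
| "polar_realise u s (_ \<^bold>: A) = (if s then u else neg_var) \<^bold>: polar_realise u s A"

text \<open>The two polarities give different formulas, so each gets one implication; negation and
  the left side of an implication exchange them.\<close>

lemma truth_lemma:
  assumes "mcs S"
  shows "(polar_realise univ_var False A \<in> S \<longrightarrow> holds A S) \<and>
    (holds A S \<longrightarrow> polar_realise univ_var True A \<in> S)"
  using assms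
proof (induction A arbitrary: S)
  case (V A)
  let ?A = "polar_realise univ_var True A"
  have "\<^bold>V ?A \<in> S" if "holds (\<^bold>V A) S"
  proof (rule ccontr)
    assume "\<^bold>V ?A \<notin> S"
    then have "\<not> valid S \<tturnstile> ?A"
      using V.prems entails_V mcs_closed by blast
    then obtain M where "mcs M" "valid S \<subseteq> M" "?A \<notin> M"
      using lindenbaum by blast
    with that V.IH show False by auto
  qed
  moreover have "holds (\<^bold>V A) S" if "\<^bold>V polar_realise univ_var False A \<in> S"
    using that V.IH by (auto simp: valid_def)
  ultimately show ?case by simp
next
  case (Mod m A)
  let ?A = "polar_realise univ_var True A"
  have "univ_var \<^bold>: ?A \<in> S" if "holds (m \<^bold>: A) S"
  proof (rule ccontr)
    assume "univ_var \<^bold>: ?A \<notin> S"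
    \<comment> \<open>Absorption: a single such \<open>t\<close> would put the formula labelled by
      \<open>univ_var\<close> into \<open>S\<close>.\<close>
    then have "t \<^bold>: ?A \<notin> S" if "univ_free t" for t
      using that Mod.prems mcs_MP LPVU_absorb by blast
    then have "\<not> proven S \<tturnstile> ?A"
      using Mod.prems entails_internalise mcs_closed by blast
    then obtain M where "mcs M" "proven S \<subseteq> M" "?A \<notin> M"
      using lindenbaum by blast
    with that Mod.IH show False by auto
  qed
  moreover have "holds (m \<^bold>: A) S" if "neg_var \<^bold>: polar_realise univ_var False A \<in> S"
  proof -
    \<comment> \<open>\<open>neg_var\<close> is itself \<open>univ_free\<close>, so what it labels
      holds at all box successors.\<close>
    have "polar_realise univ_var False A \<in> proven S"
      using that unfolding proven_def by (auto intro!: exI[of _ neg_var])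
    then show ?thesis
      using Mod.IH by auto
  qed
  ultimately show ?case by simp
qed (auto simp: mcs_Neg mcs_And mcs_Or mcs_Imp)

lemma S4V_LPVU:
  assumes "S4V\<^sup>- \<turnstile> F"
  shows "LPVU (polar_realise univ_var True F)"
proof (rule ccontr)
  let ?F = "polar_realise univ_var True F"
  assume "\<not> LPVU ?F"
  then have "\<not> {} \<tturnstile> ?F"
    using entails_empty by blast
  then obtain M where "mcs M" "?F \<notin> M"
    using lindenbaum by blast
  then show False
    using canonical_sound[OF assms] truth_lemma by simp
qed

section \<open>Normal realisations\<close>

text \<open>Fixing variable 0 keeps negative boxes realised by a variable when
  \<open>univ_var\<close> is eliminated.\<close>

lemma map_fm_polar_realise:
  assumes "\<sigma> 0 = neg_var"
  shows "map_fm (subst \<sigma>) (polar_realise univ_var s F) = polar_realise (\<sigma> 1) s F"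
  by (induction F arbitrary: s) (simp_all add: assms)

lemma realise_eq_polar_realise:
  "\<forall>p\<in>boxes s F. r p = u \<Longrightarrow> \<forall>p\<in>boxes (\<not> s) F. r p = neg_var \<Longrightarrow>
    realise r F = polar_realise u s F"
proof (induction F arbitrary: s r)
  case (Mod m F)
  then show ?case
    by (cases s) simp_all
qed simp_all

lemma boxes_disjoint: "boxes True F \<inter> boxes False F = {}"
  by (induction F) auto

theorem theorem6:
  fixes F :: s4v_fm
  assumes "S4V\<^sup>- \<turnstile> F"
  shows "\<exists>r. normal_realisation F r \<and> LPV\<^sup>- \<turnstile> realise r F"
proof -
  obtain \<sigma> where "\<sigma> 0 = neg_var" "LPV\<^sup>- \<turnstile> map_fm (subst \<sigma>) (polar_realise univ_var True F)"
    using LPVU_eliminate[OF S4V_LPVU[OF assms]] by blast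
  then have provable: "LPV\<^sup>- \<turnstile> polar_realise (\<sigma> 1) True F"
    by (simp only: map_fm_polar_realise)
  \<comment> \<open>Since no box has both polarities, the default value \<sigma> 1 reaches every
    positive box.\<close>
  define r where "r p = (if p \<in> boxes False F then neg_var else \<sigma> 1)" for p
  have "realise r F = polar_realise (\<sigma> 1) True F"
    using boxes_disjoint[of F] by (intro realise_eq_polar_realise) (auto simp: r_def)
  moreover have "normal_realisation F r"
    by (simp add: normal_realisation_def r_def)
  ultimately show ?thesis
    using provable by (intro exI[of _ r]) simp
qed

end
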